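(* Let $(G,+)$ be a finite abelian group of exponent $N$, let ${\bf F}$ be a field of characteristic $0$ or of characteristic $p$ not dividing $|G|$, let ${\bf E}\supseteq{\bf F}$ contain a primitive $N$-th root of unity, and let $\hat G$ be the group of ${\bf E}$-valued characters of $G$. Let ${\cal Z}\subseteq\hat G$ and let $C=\{f\in{\bf F}[G]: \hat f(\chi)=0\text{ for all }\chi\in{\cal Z}\}$ be the abelian code with defining zeros ${\cal Z}$. Then the minimum weight $d(C)$ of $C$ (the minimum of $|{\rm supp}(f)|$ over nonzero $f\in C$) satisfies \[ d(C)\ \ge\ \min\,\delta(\hat G,{\cal Z}'), \] where the minimum is over all ${\bf F}$-closed proper subsets ${\cal Z}'$ of $\hat G$ with ${\cal Z}'\supseteq{\cal Z}$.
   Context: Characters are homomorphisms $G\to{\bf E}^*$; $\hat G$ is the group of characters under pointwise multiplication, written additively: $(\chi+\psi)(x)=\chi(x)\psi(x)$. Elements $f\in{\bf F}[G]$ are identified with functions $f:G\to{\bf F}$, and $\hat f(\chi)=\sum_{x\in G}f(x)\chi(-x)$. A subset of $\hat G$ is ${\bf F}$-closed if it is closed under all maps $\chi\mapsto\chi^\sigma$, $\chi^\sigma(x)=\sigma(\chi(x))$, for $\sigma$ a field automorphism of ${\bf E}$ fixing ${\bf F}$ pointwise. For an abelian group $(K,+)$ and ${\cal Z}\subseteq K$, the ${\cal Z}$-independent subsets of $K$ are defined inductively: $\emptyset$ is ${\cal Z}$-independent; if ${\cal A}$ is ${\cal Z}$-independent and $\psi\in K$ then $\psi+{\cal A}$ is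 ${\cal Z}$-independent; if ${\cal A}\subseteq{\cal Z}$ is ${\cal Z}$-independent and $\eta\in K\setminus{\cal Z}$ then ${\cal A}\cup\{\eta\}$ is ${\cal Z}$-independent; only sets so obtained are ${\cal Z}$-independent. $\delta(K,{\cal Z})$ denotes the largest size of a ${\cal Z}$-independent subset of $K$. *)

theory Defs
  imports "HOL-Computational_Algebra.Polynomial" "HOL-Library.FuncSet" "HOL-Library.Cardinality" "HOL-Library.Extended_Nat"
begin

(* a subfield has the same characteristic CHAR('e) as the ambient field *)
definition is_subfield :: "'e::field set \<Rightarrow> bool" where
  "is_subfield F \<longleftrightarrow> 0 \<in> F \<and> 1 \<in> F \<and>
     (\<forall>a\<in>F. \<forall>b\<in>F. a + b \<in> F \<and> a * b \<in> F) \<and>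
     (\<forall>a\<in>F. - a \<in> F \<and> inverse a \<in> F)"

(* the sum of n copies of x is the multiple n x in the additive group *)
definition group_exponent :: "'g::ab_group_add itself \<Rightarrow> nat" where
  "group_exponent _ = (LEAST n. n > 0 \<and> (\<forall>x::'g. (\<Sum>i<n. x) = 0))"

definition primitive_root_of_unity :: "nat \<Rightarrow> 'e::field \<Rightarrow> bool" where
  "primitive_root_of_unity n z \<longleftrightarrow> z ^ n = 1 \<and> (\<forall>k. 0 < k \<and> k < n \<longrightarrow> z ^ k \<noteq> 1)"

typedef (overloaded) ('g::ab_group_add, 'e::field) character =
  "{\<chi> :: 'g \<Rightarrow> 'e. (\<forall>x. \<chi> x \<noteq> 0) \<and> (\<forall>x y. \<chi> (x + y) = \<chi> x * \<chi> y)}"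
  morphisms char_fun Abs_character
  by (rule exI[of _ "\<lambda>_. 1"]) simp

setup_lifting type_definition_character

lemma char_fun_nonzero [simp]: "char_fun \<chi> x \<noteq> 0"
  using char_fun[of \<chi>] by blast

lemma char_fun_add: "char_fun \<chi> (x + y) = char_fun \<chi> x * char_fun \<chi> y"
  using char_fun[of \<chi>] by blast

lemma char_fun_zero [simp]: "char_fun \<chi> 0 = 1"
  using char_fun_add[of \<chi> 0 0] char_fun_nonzero[of \<chi> 0] by simp

lemma char_fun_multiple: "char_fun \<chi> (\<Sum>i<n. x) = char_fun \<chi> x ^ n"
  by (induction n) (simp_all add: char_fun_add mult.commute)

instantiation character :: (ab_group_add, field) ab_group_add
begin

lift_definition zero_character :: "('a, 'b) character" is "\<lambda>_. 1"
  by simp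

lift_definition plus_character ::
  "('a, 'b) character \<Rightarrow> ('a, 'b) character \<Rightarrow> ('a, 'b) character"
  is "\<lambda>\<chi> \<psi> x. \<chi> x * \<psi> x"
  by simp

lift_definition uminus_character :: "('a, 'b) character \<Rightarrow> ('a, 'b) character"
  is "\<lambda>\<chi> x. inverse (\<chi> x)"
  by simp

lift_definition minus_character ::
  "('a, 'b) character \<Rightarrow> ('a, 'b) character \<Rightarrow> ('a, 'b) character"
  is "\<lambda>\<chi> \<psi> x. \<chi> x / \<psi> x"
  by simp

instance
  by standard (transfer; simp add: fun_eq_iff divide_simps)+

end

lemma finite_roots_of_unity:
  assumes "n > 0"
  shows "finite {z::'e::field. z ^ n = 1}"
proof -
  have "monom 1 n - 1 \<noteq> (0 :: 'e poly)"
  proof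
    assume "monom 1 n - 1 = (0 :: 'e poly)"
    then have "coeff (monom 1 n - 1 :: 'e poly) n = 0" by simp
    with assms show False by simp
  qed
  from poly_roots_finite[OF this] show ?thesis
    by (simp add: poly_monom)
qed

instance character :: ("{finite,ab_group_add}", field) finite
proof
  let ?R = "\<Union>n\<in>{1..CARD('a)}. {z::'b. z ^ n = 1}"
  have fin: "finite ?R"
    by (intro finite_UN_I finite_roots_of_unity) auto
  have root: "char_fun \<chi> x \<in> ?R" for \<chi> :: "('a, 'b) character" and x
  proof -
    have "\<not> inj_on (\<lambda>n. \<Sum>i<n. x) {0..CARD('a)}"
    proof
      assume "inj_on (\<lambda>n. \<Sum>i<n. x) {0..CARD('a)}"
      then have "card {0..CARD('a)} \<le> CARD('a)"
        by (rule card_inj_on_le) auto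
      then show False by simp
    qed
    then obtain m n where mn: "m < n" "n \<le> CARD('a)" "(\<Sum>i<m. x) = (\<Sum>i<n. x)"
      unfolding inj_on_def by (metis atLeastAtMost_iff linorder_neqE_nat)
    have "char_fun \<chi> x ^ m = char_fun \<chi> x ^ n"
      using mn(3) by (metis char_fun_multiple)
    also have "\<dots> = char_fun \<chi> x ^ m * char_fun \<chi> x ^ (n - m)"
      using mn(1) by (simp flip: power_add)
    finally have "char_fun \<chi> x ^ (n - m) = 1" by simp
    with mn show ?thesis by (intro UN_I[of "n - m"]) auto
  qed
  have "range char_fun \<subseteq> (Pi\<^sub>E UNIV (\<lambda>_. ?R) :: ('a \<Rightarrow> 'b) set)"
    using root by (intro image_subsetI PiE_I) auto
  moreover have "finite (Pi\<^sub>E UNIV (\<lambda>_. ?R) :: ('a \<Rightarrow> 'b) set)"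
    by (intro finite_PiE fin finite)
  ultimately have "finite (range (char_fun :: ('a, 'b) character \<Rightarrow> _))"
    by (rule finite_subset)
  then show "finite (UNIV :: ('a, 'b) character set)"
    by (rule finite_imageD) (simp add: inj_def char_fun_inject)
qed

definition automorphisms_fixing :: "'e::field set \<Rightarrow> ('e \<Rightarrow> 'e) set" where
  "automorphisms_fixing F = {\<sigma>. bij \<sigma> \<and>
     (\<forall>a b. \<sigma> (a + b) = \<sigma> a + \<sigma> b) \<and> (\<forall>a b. \<sigma> (a * b) = \<sigma> a * \<sigma> b) \<and>
     (\<forall>a\<in>F. \<sigma> a = a)}"

(* meaningful for field automorphisms only, see char_fun_conjugate *)
definition conjugate_character ::
  "('e \<Rightarrow> 'e) \<Rightarrow> ('g::ab_group_add, 'e::field) character \<Rightarrow> ('g, 'e) character" where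
  "conjugate_character \<sigma> \<chi> = Abs_character (\<lambda>x. \<sigma> (char_fun \<chi> x))"

lemma char_fun_conjugate:
  assumes "\<sigma> \<in> automorphisms_fixing F"
  shows "char_fun (conjugate_character \<sigma> \<chi>) x = \<sigma> (char_fun \<chi> x)"
proof -
  have inj: "inj \<sigma>" and add: "\<sigma> (a + b) = \<sigma> a + \<sigma> b"
    and mult: "\<sigma> (a * b) = \<sigma> a * \<sigma> b" for a b
    using assms by (auto simp: automorphisms_fixing_def bij_def)
  have "\<sigma> 0 = 0" using add[of 0 0] by (metis add.right_neutral add_left_cancel)
  then have "\<sigma> a \<noteq> 0" if "a \<noteq> 0" for a
    using that injD[OF inj, of a 0] by auto
  then show ?thesis
    unfolding conjugate_character_def
    by (subst Abs_character_inverse) (auto simp: char_fun_add mult)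
qed

definition closed_over ::
  "'e::field set \<Rightarrow> ('g::ab_group_add, 'e) character set \<Rightarrow> bool" where
  "closed_over F S \<longleftrightarrow>
     (\<forall>\<sigma>\<in>automorphisms_fixing F. \<forall>\<chi>\<in>S. conjugate_character \<sigma> \<chi> \<in> S)"

inductive independent_wrt :: "'k::ab_group_add set \<Rightarrow> 'k set \<Rightarrow> bool"
  for Z :: "'k set" where
  empty: "independent_wrt Z {}"
| translate: "independent_wrt Z A \<Longrightarrow> independent_wrt Z ((+) \<psi> ` A)"
| insert: "independent_wrt Z A \<Longrightarrow> A \<subseteq> Z \<Longrightarrow> \<eta> \<notin> Z \<Longrightarrow> independent_wrt Z (A \<union> {\<eta>})"

definition delta :: "'k::{finite,ab_group_add} set \<Rightarrow> nat" where
  "delta Z = Max (card ` {A. independent_wrt Z A})"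

definition fourier ::
  "('g::{finite,ab_group_add} \<Rightarrow> 'e::field) \<Rightarrow> ('g, 'e) character \<Rightarrow> 'e" where
  "fourier f \<chi> = (\<Sum>x\<in>UNIV. f x * char_fun \<chi> (- x))"

(* F[G] is represented by the functions from G to E with all values in F *)
definition abelian_code ::
  "'e::field set \<Rightarrow> ('g::{finite,ab_group_add}, 'e) character set \<Rightarrow> ('g \<Rightarrow> 'e) set" where
  "abelian_code F Z = {f. range f \<subseteq> F \<and> (\<forall>\<chi>\<in>Z. fourier f \<chi> = 0)}"

definition support :: "('g \<Rightarrow> 'e::zero) \<Rightarrow> 'g set" where
  "support f = {x. f x \<noteq> 0}"

(* in enat, so that the zero code has minimum weight \<infinity>, the minimum of the empty set *)
definition min_weight :: "('g::finite \<Rightarrow> 'e::zero) set \<Rightarrow> enat" where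
  "min_weight C = (INF f\<in>C - {\<lambda>_. 0}. enat (card (support f)))"

end

theory Submission
  imports Defs "HOL-Computational_Algebra.Primes"
begin

text \<open>
  Let \<open>\<Z>'\<close> be the zero set of the Fourier transform of a nonzero \<open>f\<close> in the code. It is
  closed over \<open>F\<close> because automorphisms fixing \<open>F\<close> commute with the transform of \<open>f\<close>, and
  the characters in a set that is independent with respect to \<open>\<Z>'\<close> restrict to linearly
  independent functions on the support of \<open>f\<close>: in a vanishing combination, multiplying by \<open>f\<close>
  and summing over the group isolates the coefficient of the unique character outside \<open>\<Z>'\<close>.
  Hence the support has at least \<open>delta \<Z>'\<close> elements. That \<open>\<Z>'\<close> is proper is the injectivity
  of the Fourier transform: its kernel is invariant under translations, which are
  simultaneously diagonalizable, so a nonzero kernel would contain a common eigenvector of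
  all translations, that is, a multiple of a character; but the transform of a character
  does not vanish.
\<close>

section \<open>Linear independence of characters on the support\<close>

lemma more_unknowns_than_equations:
  fixes v :: "'a \<Rightarrow> 'x \<Rightarrow> 'e::field"
  assumes "finite S" "finite A" "card S < card A"
  shows "\<exists>c. (\<exists>a\<in>A. c a \<noteq> 0) \<and> (\<forall>x\<in>S. (\<Sum>a\<in>A. c a * v a x) = 0)"
  using assms
proof (induction S arbitrary: A v rule: finite_induct)
  case empty
  then have "A \<noteq> {}" by auto
  then show ?case by (intro exI[of _ "\<lambda>_. 1"]) auto
next
  case (insert x S)
  show ?case
  proof (cases "\<forall>a\<in>A. v a x = 0")
    case True
    obtain c where "\<exists>a\<in>A. c a \<noteq> 0" "\<forall>y\<in>S. (\<Sum>a\<in>A. c a * v a y) = 0"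
      using insert.IH[of A v] insert.prems insert.hyps by auto
    with True show ?thesis by (intro exI[of _ c]) auto
  next
    case False
    then obtain b where b: "b \<in> A" "v b x \<noteq> 0" by auto
    \<comment> \<open>Gaussian elimination: subtracting \<open>r a\<close> times \<open>v b\<close>
      makes every other function vanish at \<open>x\<close>, so the induction hypothesis applies
      with one function and one point fewer.\<close>
    define r where "r a = v a x / v b x" for a
    have "card S < card (A - {b})"
      using insert.prems insert.hyps b by simp
    then obtain c where c: "\<exists>a\<in>A - {b}. c a \<noteq> 0"
      "\<And>y. y \<in> S \<Longrightarrow> (\<Sum>a\<in>A - {b}. c a * (v a y - r a * v b y)) = 0"
      using insert.IH[of "A - {b}" "\<lambda>a y. v a y - r a * v b y"] insert.prems by auto
    \<comment> \<open>The coefficient at \<open>b\<close> is chosen so that the combination of the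
      original functions equals that of the reduced ones.\<close>
    define d where "d a = (if a = b then - (\<Sum>a\<in>A - {b}. c a * r a) else c a)" for a
    have d: "(\<Sum>a\<in>A. d a * v a y) = (\<Sum>a\<in>A - {b}. c a * (v a y - r a * v b y))" for y
    proof -
      have "(\<Sum>a\<in>A. d a * v a y) = d b * v b y + (\<Sum>a\<in>A - {b}. c a * v a y)"
        using b insert.prems by (subst sum.remove[of A b]) (auto simp: d_def)
      also have "\<dots> = (\<Sum>a\<in>A - {b}. c a * (v a y - r a * v b y))"
        by (simp add: d_def sum_distrib_right right_diff_distrib sum_subtractf mult.assoc)
      finally show ?thesis .
    qed
    have "\<exists>a\<in>A. d a \<noteq> 0" using c(1) by (auto simp: d_def)
    moreover have "(\<Sum>a\<in>A. d a * v a x) = 0"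
      unfolding d using b by (simp add: r_def)
    ultimately show ?thesis
      using c(2) d by (intro exI[of _ d]) auto
  qed
qed

text \<open>Induction on how \<open>A\<close> is generated; \<open>c\<close> varies because a
  translation reindexes the coefficients. Values are taken at \<open>- x\<close> so that summing
  against \<open>f\<close> gives \<open>fourier\<close> directly.\<close>

lemma independent_wrt_zeros_linearly_independent:
  fixes f :: "'g::{finite,ab_group_add} \<Rightarrow> 'e::field"
  assumes "independent_wrt {\<chi>. fourier f \<chi> = 0} A"
    and "\<And>x. x \<in> support f \<Longrightarrow> (\<Sum>\<chi>\<in>A. c \<chi> * char_fun \<chi> (- x)) = 0"
    and "\<chi> \<in> A"
  shows "c \<chi> = 0"
  using assms
proof (induction arbitrary: c \<chi> rule: independent_wrt.induct)
  case empty
  then show ?case by simp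
next
  case (translate A \<psi>)
  have "(\<Sum>\<chi>\<in>A. c (\<psi> + \<chi>) * char_fun \<chi> (- x)) = 0" if "x \<in> support f" for x
  proof -
    \<comment> \<open>Translating by \<open>\<psi>\<close> multiplies all characters by one nowhere
      vanishing function, which cancels.\<close>
    have "0 = (\<Sum>\<chi>\<in>A. c (\<psi> + \<chi>) * char_fun (\<psi> + \<chi>) (- x))"
      using translate.prems(1)[OF that] by (simp add: sum.reindex)
    also have "\<dots> = char_fun \<psi> (- x) * (\<Sum>\<chi>\<in>A. c (\<psi> + \<chi>) * char_fun \<chi> (- x))"
      by (simp add: plus_character.rep_eq sum_distrib_left mult_ac)
    finally show ?thesis by simp
  qed
  from translate.IH[of "\<lambda>\<chi>. c (\<psi> + \<chi>)", OF this] translate.prems(2) show ?case by auto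
next
  case (insert A \<eta>)
  have notin: "\<eta> \<notin> A" using insert.hyps by auto
  \<comment> \<open>Off the support the factor \<open>f x\<close> is zero, so the relation on the
    support suffices.\<close>
  have "0 = (\<Sum>x\<in>UNIV. f x * (\<Sum>\<chi>\<in>A \<union> {\<eta>}. c \<chi> * char_fun \<chi> (- x)))"
    using insert.prems(1) by (intro sum.neutral[symmetric]) (auto simp: support_def)
  also have "\<dots> = (\<Sum>\<chi>\<in>A \<union> {\<eta>}. c \<chi> * fourier f \<chi>)"
    unfolding fourier_def sum_distrib_left by (subst sum.swap) (simp add: mult_ac)
  also have "\<dots> = c \<eta> * fourier f \<eta>"
    using notin insert.hyps(2) by (auto intro!: sum.neutral)
  finally have \<eta>: "c \<eta> = 0" using insert.hyps(3) by simp
  have "(\<Sum>\<chi>\<in>A. c \<chi> * char_fun \<chi> (- x)) = 0" if "x \<in> support f" for x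
    using insert.prems(1)[OF that] notin \<eta> by simp
  from insert.IH[OF this] \<eta> insert.prems(2) show ?case by auto
qed

text \<open>An independent set larger than the support would admit a nontrivial relation there, by
  counting unknowns and equations.\<close>

lemma delta_zeros_le_card_support:
  fixes f :: "'g::{finite,ab_group_add} \<Rightarrow> 'e::field"
  shows "delta {\<chi>. fourier f \<chi> = 0} \<le> card (support f)"
proof -
  have "card A \<le> card (support f)" if A: "independent_wrt {\<chi>. fourier f \<chi> = 0} A" for A
  proof (rule ccontr)
    assume "\<not> ?thesis"
    then obtain c where "\<exists>\<chi>\<in>A. c \<chi> \<noteq> 0"
      "\<forall>x\<in>support f. (\<Sum>\<chi>\<in>A. c \<chi> * char_fun \<chi> (- x)) = 0"
      using more_unknowns_than_equations[of "support f" A "\<lambda>\<chi> x. char_fun \<chi> (- x)"] by auto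
    with independent_wrt_zeros_linearly_independent[OF A, of c] show False by blast
  qed
  then show ?thesis
    unfolding delta_def by (subst Max_le_iff) (auto intro: independent_wrt.empty)
qed

lemma closed_over_zeros:
  fixes f :: "'g::{finite,ab_group_add} \<Rightarrow> 'e::field"
  assumes "range f \<subseteq> F"
  shows "closed_over F {\<chi>. fourier f \<chi> = 0}"
  unfolding closed_over_def
proof (intro ballI)
  fix \<sigma> and \<chi> :: "('g, 'e) character"
  assume \<sigma>: "\<sigma> \<in> automorphisms_fixing F" and \<chi>: "\<chi> \<in> {\<chi>. fourier f \<chi> = 0}"
  have add: "\<sigma> (a + b) = \<sigma> a + \<sigma> b" and mult: "\<sigma> (a * b) = \<sigma> a * \<sigma> b" for a b
    using \<sigma> by (auto simp: automorphisms_fixing_def)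
  have fix_f: "\<sigma> (f x) = f x" for x
    using \<sigma> assms by (simp add: automorphisms_fixing_def image_subset_iff)
  have zero: "\<sigma> 0 = 0" using add[of 0 0] by (metis add.right_neutral add_left_cancel)
  have "fourier f (conjugate_character \<sigma> \<chi>) = (\<Sum>x\<in>UNIV. \<sigma> (f x * char_fun \<chi> (- x)))"
    by (simp add: fourier_def char_fun_conjugate[OF \<sigma>] mult fix_f)
  also have "\<dots> = \<sigma> (fourier f \<chi>)"
    unfolding fourier_def
    using sum_comp_morphism[of \<sigma> "\<lambda>x. f x * char_fun \<chi> (- x)" UNIV, OF zero add]
    by (simp add: comp_def)
  finally show "conjugate_character \<sigma> \<chi> \<in> {\<chi>. fourier f \<chi> = 0}"
    using \<chi> zero by simp
qed

section \<open>Injectivity of the Fourier transform\<close>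

lemma group_exponent_pos_and_annihilates:
  "group_exponent TYPE('g::{finite,ab_group_add}) > 0 \<and>
    (\<forall>x::'g. (\<Sum>i<group_exponent TYPE('g). x) = 0)"
proof -
  have add: "(\<Sum>i<m + d. x) = (\<Sum>i<m. x) + (\<Sum>i<d. x)" for m d :: nat and x :: 'g
    by (induction d) (simp_all add: add.assoc)
  \<comment> \<open>Pigeonhole: a finite group has finitely many self-maps, so two different
    multiples agree as maps and their difference \<open>d\<close> annihilates the group.\<close>
  have "\<not> inj (\<lambda>(n::nat) (x::'g). \<Sum>i<n. x)"
    using finite_imageD[of "\<lambda>(n::nat) (x::'g). \<Sum>i<n. x" UNIV] by auto
  then obtain m n :: nat where "m < n" and eq: "(\<lambda>x::'g. \<Sum>i<m. x) = (\<lambda>x. \<Sum>i<n. x)"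
    unfolding inj_def by (metis linorder_neqE_nat)
  then obtain d where d: "n = m + d" "d > 0"
    using less_imp_add_positive by blast
  have "(\<Sum>i<d. x) = 0" for x :: 'g
    using fun_cong[OF eq, of x] unfolding d(1) add by simp
  with d(2) have "d > 0 \<and> (\<forall>x::'g. (\<Sum>i<d. x) = 0)" by blast
  then show ?thesis
    unfolding group_exponent_def by (rule LeastI)
qed

text \<open>If the characteristic \<open>p\<close> divided \<open>N = p * m\<close>, the Frobenius
  map would turn \<open>\<zeta> ^ N = 1\<close> into \<open>\<zeta> ^ m = 1\<close> with
  \<open>m < N\<close>.\<close>

lemma primitive_root_of_unity_of_nat_nonzero:
  fixes \<zeta> :: "'e::field"
  assumes "primitive_root_of_unity N \<zeta>" "N > 0"
  shows "(of_nat N :: 'e) \<noteq> 0"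
proof
  let ?p = "CHAR('e)"
  assume "(of_nat N :: 'e) = 0"
  then obtain m where m: "N = ?p * m"
    by (auto simp: of_nat_eq_0_iff_char_dvd)
  with assms(2) have "?p > 0" "m > 0" by auto
  then have p: "prime ?p" by (intro prime_CHAR_semidom)
  have "(\<zeta> ^ m - 1 + 1) ^ ?p = (\<zeta> ^ m - 1) ^ ?p + 1 ^ ?p"
    by (rule freshmans_dream[OF p refl])
  moreover have "(\<zeta> ^ m) ^ ?p = 1"
    using assms(1) m by (simp add: primitive_root_of_unity_def mult.commute flip: power_mult)
  ultimately have "(\<zeta> ^ m - 1) ^ ?p = 0" by simp
  then have "\<zeta> ^ m = 1" by simp
  moreover have "m < N"
    using m \<open>m > 0\<close> prime_gt_1_nat[OF p] by simp
  ultimately show False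
    using assms(1) \<open>m > 0\<close> by (auto simp: primitive_root_of_unity_def)
qed

lemma sum_powers_primitive_root_of_unity:
  assumes "primitive_root_of_unity N \<zeta>" "0 < k" "k < N"
  shows "(\<Sum>i<N. \<zeta> ^ (i * k)) = 0"
proof -
  have "(\<zeta> ^ k) ^ N = (\<zeta> ^ N) ^ k"
    by (simp add: mult.commute flip: power_mult)
  then have "\<zeta> ^ k \<noteq> 1" "(\<zeta> ^ k) ^ N = 1"
    using assms by (auto simp: primitive_root_of_unity_def)
  moreover have "(\<Sum>i<N. \<zeta> ^ (i * k)) = (\<Sum>i<N. (\<zeta> ^ k) ^ i)"
    by (simp add: mult.commute flip: power_mult)
  ultimately show ?thesis by (simp add: geometric_sum)
qed

text \<open>This makes the kernel of the transform invariant under translations.\<close>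

lemma fourier_translate:
  "fourier (\<lambda>y. f (y + a)) \<chi> = char_fun \<chi> a * fourier f \<chi>"
proof -
  have "fourier (\<lambda>y. f (y + a)) \<chi> = (\<Sum>y\<in>UNIV. f (y + a) * char_fun \<chi> (- (y + a) + a))"
    by (simp add: fourier_def)
  also have "\<dots> = (\<Sum>y\<in>UNIV. f y * char_fun \<chi> (- y + a))"
    by (rule sum.reindex_bij_witness[of _ "\<lambda>y. y - a" "\<lambda>y. y + a"]) auto
  also have "\<dots> = char_fun \<chi> a * fourier f \<chi>"
    unfolding fourier_def sum_distrib_left
    by (intro sum.cong refl) (simp only: char_fun_add mult_ac)
  finally show ?thesis .
qed

lemma fourier_sum_cmult:
  "fourier (\<lambda>y. \<Sum>k\<in>K. c k * h k y) \<chi> = (\<Sum>k\<in>K. c k * fourier (h k) \<chi>)"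
  unfolding fourier_def sum_distrib_left sum_distrib_right
  by (subst sum.swap) (simp add: mult_ac)

text \<open>Translations are diagonalized one at a time: projecting to an eigenspace of the new one
  preserves the eigenvector property for the earlier ones, since translations commute.\<close>

lemma translation_common_eigenvector:
  fixes f :: "'g::{finite,ab_group_add} \<Rightarrow> 'e::field" and S :: "'g set"
  assumes \<zeta>: "primitive_root_of_unity (group_exponent TYPE('g)) (\<zeta>::'e)"
    and "f x\<^sub>0 \<noteq> 0" "\<And>\<chi>. fourier f \<chi> = 0"
  shows "\<exists>g y\<^sub>0. g y\<^sub>0 \<noteq> 0 \<and> (\<forall>\<chi>. fourier g \<chi> = (0::'e)) \<and>
    (\<forall>x\<in>S. \<exists>l. \<forall>y. g (y + x) = l * g y)"
proof (induction S rule: finite_induct[OF finite])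
  case 1
  show ?case using assms(2,3) by auto
next
  case (2 x S)
  let ?N = "group_exponent TYPE('g)"
  define m where "m k = (\<Sum>i<k. x)" for k :: nat
  have m0: "m 0 = 0" and mS: "m (Suc k) = m k + x" for k
    by (simp_all add: m_def)
  have N: "?N > 0" and mN: "m ?N = 0"
    using group_exponent_pos_and_annihilates[where 'g = 'g] by (auto simp: m_def)
  from 2 obtain g :: "'g \<Rightarrow> 'e" and y\<^sub>0 where g: "g y\<^sub>0 \<noteq> 0" "\<And>\<chi>. fourier g \<chi> = 0"
    and eig: "\<And>z. z \<in> S \<Longrightarrow> \<exists>l. \<forall>y. g (y + z) = l * g y" by blast
  \<comment> \<open>Up to a factor, the projection of \<open>g\<close> to an eigenspace of the translation by \<open>x\<close>.\<close>
  define P where "P i y = (\<Sum>k<?N. \<zeta> ^ (i * k) * g (y + m k))" for i y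
  \<comment> \<open>The projections add up to \<open>?N\<close> times \<open>g\<close>, because the
    inner sums vanish for \<open>k > 0\<close>; hence one of them is nonzero at the same
    point.\<close>
  have "(\<Sum>i<?N. P i y\<^sub>0) = (\<Sum>k<?N. (\<Sum>i<?N. \<zeta> ^ (i * k)) * g (y\<^sub>0 + m k))"
    unfolding P_def sum_distrib_right by (rule sum.swap)
  also have "\<dots> = (\<Sum>k<?N. if k = 0 then of_nat ?N * g y\<^sub>0 else 0)"
    by (intro sum.cong refl) (auto simp: m0 sum_powers_primitive_root_of_unity[OF \<zeta>])
  also have "\<dots> = of_nat ?N * g y\<^sub>0"
    using N by simp
  also have "\<dots> \<noteq> 0"
    using g(1) primitive_root_of_unity_of_nat_nonzero[OF \<zeta> N] by simp
  finally obtain i where i: "P i y\<^sub>0 \<noteq> 0"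
    by (metis sum.neutral)
  have ft: "fourier (P i) \<chi> = 0" for \<chi>
    unfolding P_def[abs_def] fourier_sum_cmult fourier_translate g(2) by simp
  have one: "\<zeta> ^ ?N = 1" using \<zeta> by (simp add: primitive_root_of_unity_def)
  have "\<zeta> \<noteq> 0" using one N by (metis power_0_left less_numeral_extra(3) zero_neq_one)
  have "P i (y + x) = inverse (\<zeta> ^ i) * P i y" for y
  proof -
    let ?h = "\<lambda>k. \<zeta> ^ (i * k) * g (y + m k)"
    \<comment> \<open>Translation by \<open>x\<close> shifts the index \<open>k\<close> by one, and
      the sum wraps around because \<open>?h ?N = ?h 0\<close>.\<close>
    have "\<zeta> ^ i * P i (y + x) = (\<Sum>k<?N. ?h (Suc k))"
      by (simp add: P_def sum_distrib_left mS power_add ac_simps)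
    also have "\<dots> = P i y"
    proof -
      have "?h ?N = ?h 0" by (simp add: mN m0 one mult.commute[of i] power_mult)
      moreover have "sum ?h {..<Suc ?N} = ?h 0 + (\<Sum>k<?N. ?h (Suc k))"
        by (rule sum.lessThan_Suc_shift)
      ultimately show ?thesis by (simp add: P_def)
    qed
    finally show ?thesis using \<open>\<zeta> \<noteq> 0\<close> by (simp add: field_simps)
  qed
  moreover have "\<exists>l. \<forall>y. P i (y + z) = l * P i y" if "z \<in> S" for z
  proof -
    obtain l where l: "\<And>y. g (y + z) = l * g y" using eig \<open>z \<in> S\<close> by blast
    have "P i (y + z) = l * P i y" for y
    proof -
      have "g (y + z + m k) = l * g (y + m k)" for k
        using l[of "y + m k"] by (simp add: ac_simps)
      then show ?thesis by (simp add: P_def sum_distrib_left mult_ac)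
    qed
    then show ?thesis by blast
  qed
  ultimately show ?case
    using i ft by (intro exI[of _ "P i"] exI[of _ y\<^sub>0]) blast
qed

lemma fourier_nonzero:
  fixes f :: "'g::{finite,ab_group_add} \<Rightarrow> 'e::field"
  assumes "primitive_root_of_unity (group_exponent TYPE('g)) (\<zeta>::'e)"
    and "(of_nat CARD('g) :: 'e) \<noteq> 0" and "f x\<^sub>0 \<noteq> 0"
  shows "\<exists>\<chi>. fourier f \<chi> \<noteq> 0"
proof (rule ccontr)
  assume "\<not> ?thesis"
  then obtain g :: "'g \<Rightarrow> 'e" and y\<^sub>0 where g: "g y\<^sub>0 \<noteq> 0" "\<And>\<chi>. fourier g \<chi> = 0"
    and "\<forall>x. \<exists>l. \<forall>y. g (y + x) = l * g y"
    using translation_common_eigenvector[OF assms(1), of f x\<^sub>0 UNIV] assms(3) by auto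
  then obtain l where l: "\<And>x y. g (y + x) = l x * g y" by metis
  \<comment> \<open>Composing translations multiplies eigenvalues, so \<open>l\<close> is a
    character.\<close>
  have "l (x + y) = l x * l y" for x y
  proof -
    have "l (x + y) * g y\<^sub>0 = l x * l y * g y\<^sub>0"
      using l[of y\<^sub>0 "x + y"] l[of "y\<^sub>0 + y" x] l[of y\<^sub>0 y] by (simp add: ac_simps)
    then show ?thesis using g(1) by simp
  qed
  moreover have "l x \<noteq> 0" for x
    using l[of "y\<^sub>0 - x" x] g(1) by auto
  ultimately have \<chi>: "char_fun (Abs_character l) = l"
    by (intro Abs_character_inverse) auto
  \<comment> \<open>Thus \<open>g\<close> is \<open>g 0\<close> times \<open>l\<close>, and every
    term of its transform at \<open>l\<close> equals \<open>g 0\<close>.\<close>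
  have "g x * l (- x) = g 0" for x
    using l[of x "- x"] by simp
  then have "fourier g (Abs_character l) = of_nat CARD('g) * g 0"
    by (simp add: fourier_def \<chi>)
  moreover have "g 0 \<noteq> 0"
    using l[of 0 y\<^sub>0] g(1) by auto
  ultimately show False using g(2) assms(2) by simp
qed

theorem mainTheorem3:
  fixes F :: "'e::field set"
    and \<Z> :: "('g::{finite,ab_group_add}, 'e) character set"
    and N :: nat
  assumes "N = group_exponent TYPE('g)"
    and "is_subfield F"
    and "CHAR('e) = 0 \<or> \<not> CHAR('e) dvd CARD('g)"
    and "\<exists>\<zeta>::'e. primitive_root_of_unity N \<zeta>"
  shows "min_weight (abelian_code F \<Z>) \<ge>
    (INF \<Z>'\<in>{\<Z>'. closed_over F \<Z>' \<and> \<Z>' \<noteq> UNIV \<and> \<Z> \<subseteq> \<Z>'}. enat (delta \<Z>'))"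
  unfolding min_weight_def
proof (rule INF_greatest)
  fix f assume f: "f \<in> abelian_code F \<Z> - {\<lambda>_. 0}"
  let ?\<Z> = "{\<chi>. fourier f \<chi> = 0}"
  \<comment> \<open>In characteristic 0 this holds because the group is nonempty.\<close>
  have "(of_nat CARD('g) :: 'e) \<noteq> 0"
    using assms(3) by (auto simp: of_nat_eq_0_iff_char_dvd)
  moreover obtain x where "f x \<noteq> 0" using f by auto
  ultimately have "?\<Z> \<noteq> UNIV"
    using fourier_nonzero assms(1,4) by blast
  moreover have "closed_over F ?\<Z>" "\<Z> \<subseteq> ?\<Z>"
    using f by (auto simp: abelian_code_def intro!: closed_over_zeros)
  ultimately have "(INF \<Z>'\<in>{\<Z>'. closed_over F \<Z>' \<and> \<Z>' \<noteq> UNIV \<and> \<Z> \<subseteq> \<Z>'}. enat (delta \<Z>'))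
      \<le> enat (delta ?\<Z>)"
    by (intro INF_lower) simp
  also have "\<dots> \<le> enat (card (support f))"
    using delta_zeros_le_card_support by simp
  finally show "(INF \<Z>'\<in>{\<Z>'. closed_over F \<Z>' \<and> \<Z>' \<noteq> UNIV \<and> \<Z> \<subseteq> \<Z>'}. enat (delta \<Z>'))
      \<le> enat (card (support f))" .
qed

end
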